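(* Let $\lambda$ be a nonzero real number and let $n\ge 0$ be an integer. Then, as functions of $x$, \[ \frac{1}{e^{x}}\,(XD)_{n,\lambda}\,e^{x}=\phi_{n,\lambda}(x), \] where $X$ is the operator of multiplication by $x$, $D=\frac{d}{dx}$, and $(XD)_{n,\lambda}$ is the operator $(XD)(XD-\lambda)(XD-2\lambda)\cdots(XD-(n-1)\lambda)$ (the identity operator when $n=0$).
   Context: For nonzero real $\lambda$, the degenerate falling factorial is $(x)_{0,\lambda}=1$, $(x)_{n,\lambda}=x(x-\lambda)(x-2\lambda)\cdots(x-(n-1)\lambda)$ for $n\ge1$. For an operator $T$, $(T)_{n,\lambda}$ denotes $T(T-\lambda)\cdots(T-(n-1)\lambda)$ (identity if $n=0$). The degenerate exponentials are the formal power series $e_\lambda^{x}(t)=\sum_{n\ge0}(x)_{n,\lambda}\frac{t^n}{n!}$ and $e_\lambda(t)=e_\lambda^{1}(t)$. The degenerate Bell polynomials $\phi_{n,\lambda}(x)$ are defined by $e^{x(e_\lambda(t)-1)}=\sum_{n\ge0}\phi_{n,\lambda}(x)\frac{t^n}{n!}$; equivalently $\phi_{n,\lambda}(x)=\sum_{k=0}^n {n\brace k}_\lambda x^k$, where the degenerate Stirling numbers of the second kind ${n\brace k}_\lambda$ are defined by $(x)_{n,\lambda}=\sum_{k=0}^n {n\brace k}_\lambda (x)_k$ with $(x)_k=x(x-1)\cdots(x-k+1)$, $(x)_0=1$. *)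

theory Defs
  imports "HOL-Analysis.Analysis" "HOL-Computational_Algebra.Formal_Power_Series"
begin

definition deg_falling :: "real \<Rightarrow> real \<Rightarrow> nat \<Rightarrow> real" where
  "deg_falling lam x n = (\<Prod>i<n. x - real i * lam)"

definition deg_exp :: "real \<Rightarrow> real \<Rightarrow> real fps" where
  "deg_exp lam x = Abs_fps (\<lambda>n. deg_falling lam x n / fact n)"

text \<open>
  The series \<open>deg_exp lam 1 - 1\<close> has zero constant term, so the composition below is the
  genuine formal substitution, i.e. the series $e^{x(e_\lambda(t)-1)}$ in $t$.
\<close>

definition deg_bell :: "real \<Rightarrow> nat \<Rightarrow> real \<Rightarrow> real" where
  "deg_bell lam n x =
     fact n * fps_nth (fps_compose (fps_exp 1) (fps_const x * (deg_exp lam 1 - 1))) n"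

type_synonym fun_op = "(real \<Rightarrow> real) \<Rightarrow> (real \<Rightarrow> real)"

definition X_op :: fun_op where
  "X_op f = (\<lambda>x. x * f x)"

text \<open>
  \<open>deriv\<close> is total and returns an unspecified value where its argument is not differentiable;
  \<open>D_op\<close> is meaningful on differentiable functions only.
\<close>

definition D_op :: fun_op where
  "D_op f = deriv f"

definition shift_op :: "fun_op \<Rightarrow> real \<Rightarrow> fun_op" where
  "shift_op T c f = (\<lambda>x. T f x - c * f x)"

text \<open>
  $T (T - \lambda) \cdots (T - (n-1)\lambda)$, with the rightmost factor applied first.
\<close>

primrec deg_falling_op :: "real \<Rightarrow> fun_op \<Rightarrow> nat \<Rightarrow> fun_op" where
  "deg_falling_op lam T 0 = id"
| "deg_falling_op lam T (Suc n) = deg_falling_op lam T n \<circ> shift_op T (real n * lam)"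

end

theory Submission
  imports Defs
begin

text \<open>
  On a power series, \<open>X D\<close> multiplies the coefficient of \<open>x ^ k\<close> by \<open>k\<close>, so the degenerate falling
  factorial of \<open>X D\<close> multiplies it by \<open>(k)\<^bsub>n,\<lambda>\<^esub>\<close>. Applied to \<open>e\<^sup>x\<close> this gives
  \<open>\<Sum>k. (k)\<^bsub>n,\<lambda>\<^esub> x\<^sup>k / k!\<close>. On the other side, \<open>(m)\<^bsub>n,\<lambda>\<^esub> / n!\<close> is the coefficient of \<open>t\<^sup>n\<close> in
  \<open>e\<^sub>\<lambda>(t)\<^sup>m = (1 + (e\<^sub>\<lambda>(t) - 1))\<^sup>m\<close>; expanding binomially and summing over \<open>m\<close> first gives \<open>e\<^sup>x \<phi>\<^bsub>n,\<lambda>\<^esub>(x)\<close>,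
  a Dobinski formula.
\<close>

text \<open>Convergence at every real point makes the radius infinite, so termwise differentiation
  is valid everywhere.\<close>

lemma power_series_euler_operator:
  fixes a :: "nat \<Rightarrow> real"
  assumes "\<And>x. (\<lambda>k. a k * x ^ k) sums f x"
  shows "(\<lambda>k. real k * a k * x ^ k) sums (x * deriv f x)"
proof -
  have summable: "summable (\<lambda>k. a k * y ^ k)" for y
    using assms sums_summable by blast
  have f: "f = (\<lambda>x. \<Sum>k. a k * x ^ k)"
    using assms by (auto simp: sums_iff)
  have "deriv f x = (\<Sum>k. diffs a k * x ^ k)"
    unfolding f by (intro DERIV_imp_deriv termdiffs_strong_converges_everywhere summable)
  moreover have "(\<lambda>k. real k * a k * x ^ (k - Suc 0)) sums (\<Sum>k. diffs a k * x ^ k)"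
    by (intro diffs_equiv termdiff_converges_all summable)
  ultimately have "(\<lambda>k. x * (real k * a k * x ^ (k - Suc 0))) sums (x * deriv f x)"
    by (auto intro: sums_mult)
  \<comment> \<open>At \<open>k = 0\<close> the truncated exponent is harmless: the factor
    \<open>real k\<close> vanishes.\<close>
  moreover have "x * (real k * a k * x ^ (k - Suc 0)) = real k * a k * x ^ k" for k
    by (cases k) auto
  ultimately show ?thesis by simp
qed

lemma power_series_deg_falling_op:
  fixes a :: "nat \<Rightarrow> real"
  assumes "\<And>x. (\<lambda>k. a k * x ^ k) sums f x"
  shows "(\<lambda>k. deg_falling lam (real k) n * a k * x ^ k) sums
           deg_falling_op lam (X_op \<circ> D_op) n f x"
  using assms
\<comment> \<open>The rightmost factor acts first and changes both the function and its
  coefficients, hence the generalization over \<open>a\<close> and \<open>f\<close>.\<close>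
proof (induction n arbitrary: a f)
  case 0
  then show ?case by (simp add: deg_falling_def)
next
  case (Suc n)
  have "(\<lambda>k. ((real k - real n * lam) * a k) * x ^ k) sums
          shift_op (X_op \<circ> D_op) (real n * lam) f x" for x
    using sums_diff[OF power_series_euler_operator[of a f x, OF Suc.prems]
        sums_mult[OF Suc.prems, of "real n * lam" x]]
    by (simp add: shift_op_def X_op_def D_op_def algebra_simps)
  from Suc.IH[OF this] show ?case
    by (simp add: deg_falling_def mult_ac o_def)
qed

text \<open>Taking \<open>lam\<close> out of each factor identifies \<open>deg_exp lam x\<close>
  with the binomial series of (1 + lam t)^(x/lam); its exponent law is then Vandermonde's
  convolution.\<close>

lemma deg_falling_eq_gbinomial:
  assumes "lam \<noteq> 0"
  shows "deg_falling lam x n / fact n = lam ^ n * ((x / lam) gchoose n)"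
proof -
  have "deg_falling lam x n = (\<Prod>i<n. lam * (x / lam - real i))"
    unfolding deg_falling_def using assms by (intro prod.cong) (auto simp: field_simps)
  then show ?thesis
    by (simp add: gbinomial_prod_rev prod.distrib atLeast0LessThan)
qed

lemma deg_exp_add:
  assumes "lam \<noteq> 0"
  shows "deg_exp lam (x + y) = deg_exp lam x * deg_exp lam y"
proof (rule fps_ext)
  fix n
  have "lam ^ n * ((x / lam + y / lam) gchoose n) =
      (\<Sum>i=0..n. (lam ^ i * ((x / lam) gchoose i)) * (lam ^ (n - i) * ((y / lam) gchoose (n - i))))"
    unfolding gbinomial_Vandermonde[symmetric] sum_distrib_left
    by (intro sum.cong) (auto simp: power_add[symmetric])
  then show "fps_nth (deg_exp lam (x + y)) n = fps_nth (deg_exp lam x * deg_exp lam y) n"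
    by (simp add: deg_exp_def fps_mult_nth deg_falling_eq_gbinomial[OF assms] add_divide_distrib)
qed

lemma deg_exp_0: "deg_exp lam 0 = 1"
  by (rule fps_ext) (auto simp: deg_exp_def deg_falling_def)

lemma deg_exp_of_nat:
  assumes "lam \<noteq> 0"
  shows "deg_exp lam (real m) = deg_exp lam 1 ^ m"
  by (induction m) (auto simp: deg_exp_0 deg_exp_add[OF assms])

text \<open>The coefficient of \<open>real (m choose k)\<close> is k! times the degenerate Stirling
  number. The range \<open>k \<le> n\<close> does not depend on \<open>m\<close>, so summing over
  \<open>m\<close> termwise is legitimate later.\<close>

lemma deg_falling_of_nat:
  assumes "lam \<noteq> 0"
  shows "deg_falling lam (real m) n =
    (\<Sum>k\<le>n. fact n * fps_nth ((deg_exp lam 1 - 1) ^ k) n * real (m choose k))"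
proof -
  define c where "c k = fps_nth ((deg_exp lam 1 - 1) ^ k) n" for k
  \<comment> \<open>The base has zero constant term, so its \<open>k\<close>-th power starts at t^k
    or later.\<close>
  have c_eq_0: "c k = 0" if "n < k" for k
    unfolding c_def using that
    by (intro startsby_zero_power_prefix[rule_format]) (auto simp: deg_exp_def deg_falling_def)
  have "deg_falling lam (real m) n / fact n = fps_nth (((deg_exp lam 1 - 1) + 1) ^ m) n"
    using deg_exp_of_nat[OF assms, of m] by (simp add: deg_exp_def fps_eq_iff)
  also have "\<dots> = (\<Sum>k\<le>m. real (m choose k) * c k)"
    unfolding binomial_ring
    by (simp add: c_def fps_sum_nth fps_of_nat[symmetric] mult.assoc del: fps_of_nat)
  also have "\<dots> = (\<Sum>k\<le>max m n. real (m choose k) * c k)"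
    by (intro sum.mono_neutral_left) auto
  also have "\<dots> = (\<Sum>k\<le>n. real (m choose k) * c k)"
    by (intro sum.mono_neutral_right) (auto simp: c_eq_0)
  finally show ?thesis
    by (simp add: c_def field_simps sum_distrib_left)
qed

text \<open>For \<open>m \<ge> k\<close> the coefficient is 1/(k! (m-k)!), so this is the
  exponential series shifted by \<open>k\<close>; the first \<open>k\<close> terms are zero.\<close>

lemma binomial_exp_sums:
  fixes x :: real
  shows "(\<lambda>m. real (m choose k) * x ^ m / fact m) sums (x ^ k / fact k * exp x)"
proof -
  have "(\<lambda>m. x ^ m / fact m) sums exp x"
    using exp_converges[of x] by (simp add: field_simps)
  then have "(\<lambda>m. x ^ k / fact k * (x ^ m / fact m)) sums (x ^ k / fact k * exp x)"
    by (rule sums_mult)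
  moreover have "x ^ k / fact k * (x ^ m / fact m) = real ((m + k) choose k) * x ^ (m + k) / fact (m + k)" for m
    by (simp add: binomial_fact power_add field_simps)
  ultimately have "(\<lambda>m. real ((m + k) choose k) * x ^ (m + k) / fact (m + k)) sums
      (x ^ k / fact k * exp x)"
    by simp
  then show ?thesis
    by (subst (asm) sums_iff_shift) (simp add: binomial_eq_0)
qed

lemma deg_bell_eq_sum:
  "deg_bell lam n x = (\<Sum>k\<le>n. fact n * fps_nth ((deg_exp lam 1 - 1) ^ k) n * (x ^ k / fact k))"
  by (simp add: deg_bell_def fps_compose_nth power_mult_distrib fps_const_power sum_distrib_left
      atLeast0AtMost mult_ac)

lemma deg_bell_dobinski:
  assumes "lam \<noteq> 0"
  shows "(\<lambda>m. deg_falling lam (real m) n * x ^ m / fact m) sums (exp x * deg_bell lam n x)"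
proof -
  let ?c = "\<lambda>k. fact n * fps_nth ((deg_exp lam 1 - 1) ^ k) n"
  have "(\<lambda>m. \<Sum>k\<le>n. ?c k * (real (m choose k) * x ^ m / fact m)) sums
      (\<Sum>k\<le>n. ?c k * (x ^ k / fact k * exp x))"
    by (intro sums_sum sums_mult binomial_exp_sums)
  then show ?thesis
    by (simp add: deg_falling_of_nat[OF assms] deg_bell_eq_sum sum_distrib_left sum_distrib_right
        sum_divide_distrib mult_ac)
qed

theorem theorem2p1:
  fixes lam :: real and n :: nat
  assumes "lam \<noteq> 0"
  shows "(\<lambda>x::real. (1 / exp x) * deg_falling_op lam (X_op \<circ> D_op) n exp x) = deg_bell lam n"
proof
  fix x :: real
  have "(\<lambda>k. 1 / fact k * y ^ k) sums exp y" for y :: real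
    using exp_converges[of y] by (simp add: field_simps)
  from power_series_deg_falling_op[of _ exp, OF this]
  have "(\<lambda>k. deg_falling lam (real k) n * x ^ k / fact k) sums
      deg_falling_op lam (X_op \<circ> D_op) n exp x"
    by simp
  \<comment> \<open>Both sides are sums of the same series, so uniqueness of limits equates
    them.\<close>
  with deg_bell_dobinski[OF assms]
  have "deg_falling_op lam (X_op \<circ> D_op) n exp x = exp x * deg_bell lam n x"
    using sums_unique2 by blast
  then show "(1 / exp x) * deg_falling_op lam (X_op \<circ> D_op) n exp x = deg_bell lam n x"
    by simp
qed

end
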